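(* Let $\lambda_n=4\sqrt{2}\,\sigma\sqrt{\log(p/\eta)/n}$ with $\eta\in(0,1)$ and $\mu_n=\frac{\lambda_n\sqrt{|\mathcal{A}^*|}}{2|\widetilde J\beta^*|_2}$. Let $\mathcal{B}\subset\{1,\dots,p\}$ be a set with $\mathcal{B}\supset\mathcal{A}^*$ and $|\mathcal{B}|\le c_{\widetilde J}|\mathcal{A}^*|$ for a given constant $c_{\widetilde J}\ge 1$. Put $\varrho_n=4\sqrt{|\mathcal{A}^*|}+\frac{4\mu_n}{\lambda_n}|\widetilde J\beta^*|_2$ and suppose that the following restricted-eigenvalue condition holds: there is a constant $\phi_{\mu_n}>0$ such that $\Delta'K_n\Delta\ge\phi_{\mu_n}\sum_{j\in\mathcal{B}}\Delta_j^2$ for any $\Delta\in\mathbb{R}^p$ satisfying $\sum_{j\notin\mathcal{B}}|\Delta_j|\le\varrho_n\sqrt{\sum_{j\in\mathcal{B}}\Delta_j^2}$. (1) Then $\varrho_n=6\sqrt{|\mathcal{A}^*|}$, and with probability greater than $1-\eta$ we have $$\left\|X\beta^*-X\hat\beta^{Quad}\right\|_n^2\le\frac{288\,\sigma^2}{\phi_{\mu_n}}\,\frac{\log(p/\eta)}{n}\,|\mathcal{A}^*|$$ and $$|\beta^*-\hat\beta^{Quad}|_1\le\frac{72\sqrt2\,\sigma}{\phi_{\mu_n}}\sqrt{\frac{\log(p/\eta)}{n}}\,|\mathcal{A}^*|.$$ (2) Assume furthermore that the Gram matrix $\Psi^n$ is such that $\phi_0<\lambda_n^2|\mathcal{A}^*|$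 and that the extended Gram matrix $K_n$ is such that $\phi_{\mu_n}\ge\mu_n$. Then the bound on the Lasso (obtained by setting $\mu_n=0$ above) does not guarantee any control on the errors. In contrast, with probability greater than $1-\eta$, $\hat\beta^{Quad}$ satisfies $$\left\|X\beta^*-X\hat\beta^{Quad}\right\|_n^2\le 72\sqrt2\,\sigma\,|\widetilde J\beta^*|_2\sqrt{\frac{\log(p/\eta)}{n}|\mathcal{A}^*|},$$ and, if $\phi_{\mu_n}\ge\sqrt{\mu_n}$, $$|\beta^*-\hat\beta^{Quad}|_1\le 36\sqrt{\sigma|\widetilde J\beta^*|_2}\left(\frac{\log(p/\eta)}{n}\right)^{1/4}|\mathcal{A}^*|^{3/4}.$$
   Context: Linear regression model: $X\in\mathbb{R}^{n\times p}$ is a deterministic design matrix, $\beta^*\in\mathbb{R}^p$ is the unknown parameter and $Y=X\beta^*+\varepsilon$, where $\varepsilon=(\varepsilon_1,\dots,\varepsilon_n)'$ has i.i.d. centered Gaussian entries with known variance $\sigma^2$. The sparsity set is $\mathcal{A}^*=\{j:\beta_j^*\ne 0\}$. Notation: $'$ is transposition; $\|a\|_n^2=n^{-1}\sum_{i=1}^n a_i^2$ for $a\in\mathbb{R}^n$; $|\cdot|_q$ is the usual $\ell_q$ norm of a vector and $|S|$ the cardinality of a finite set $S$. $\mathbf{J}$ is a given real $d\times p$ matrix ($d\ge1$) and $\widetilde J=\mathbf{J}'\mathbf{J}$. The estimator $\hat\beta^{Quad}$ with tuning parameters $\lambda_n,\mu_n$ is the solution of $$\min_{\beta\in\mathbb{R}^p}\left\{\|Y-X\beta\|_n^2+\lambda_n|\beta|_1+\mu_n\beta'\mathbf{J}'\mathbf{J}\beta\right\};$$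 the Lasso is the case $\mu_n=0$. Finally $\Psi^n=n^{-1}X'X$ is the Gram matrix and $K_n=\Psi^n+\mu_n\widetilde J$ the extended Gram matrix. The number $\phi_0$ denotes the constant $\phi_{\mu_n}$ of the restricted-eigenvalue condition in the case $\mu_n=0$ (the case of the Lasso estimator), where $K_n=\Psi^n$.
   Formalization: The formal theorem additionally assumes that every column X_j satisfies ||X_j||_n ≤ 1 and that B contains the support of J̃β* (the claim fails without either), and makes explicit σ > 0 and J̃β* ≠ 0, needed for ϱ_n and μ_n to be defined. *)

theory Defs
  imports "HOL-Probability.Probability"
begin

definition l1_norm :: "real ^ 'p \<Rightarrow> real" where
  "l1_norm v = (\<Sum>j\<in>UNIV. \<bar>v $ j\<bar>)"

definition emp_norm :: "real ^ 'n \<Rightarrow> real" where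
  "emp_norm a = sqrt ((\<Sum>i\<in>UNIV. (a $ i)\<^sup>2) / real CARD('n))"

definition sparsity_set :: "real ^ 'p \<Rightarrow> 'p set" where
  "sparsity_set b = {j. b $ j \<noteq> 0}"

definition J_tilde :: "real ^ 'p ^ 'd \<Rightarrow> real ^ 'p ^ 'p" where
  "J_tilde J = transpose J ** J"

definition gram :: "real ^ 'p ^ 'n \<Rightarrow> real ^ 'p ^ 'p" where
  "gram X = (1 / real CARD('n)) *\<^sub>R (transpose X ** X)"

definition ext_gram :: "real ^ 'p ^ 'n \<Rightarrow> real ^ 'p ^ 'd \<Rightarrow> real \<Rightarrow> real ^ 'p ^ 'p" where
  "ext_gram X J mu = gram X + mu *\<^sub>R J_tilde J"

definition response :: "real ^ 'p ^ 'n \<Rightarrow> real ^ 'p \<Rightarrow> ('n \<Rightarrow> 'w \<Rightarrow> real) \<Rightarrow> 'w \<Rightarrow> real ^ 'n" where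
  "response X beta eps \<omega> = X *v beta + (\<chi> i. eps i \<omega>)"

definition quad_criterion ::
  "real ^ 'p ^ 'n \<Rightarrow> real ^ 'p ^ 'd \<Rightarrow> real \<Rightarrow> real \<Rightarrow> real ^ 'n \<Rightarrow> real ^ 'p \<Rightarrow> real" where
  "quad_criterion X J lam mu y b =
     (emp_norm (y - X *v b))\<^sup>2 + lam * l1_norm b + mu * (b \<bullet> (J_tilde J *v b))"

(* The minimiser need not be unique; any minimiser counts as the estimator.
   The Lasso is the case mu = 0. *)
definition is_quad_estimator ::
  "real ^ 'p ^ 'n \<Rightarrow> real ^ 'p ^ 'd \<Rightarrow> real \<Rightarrow> real \<Rightarrow> real ^ 'n \<Rightarrow> real ^ 'p \<Rightarrow> bool" where
  "is_quad_estimator X J lam mu y b \<longleftrightarrow> is_arg_min (quad_criterion X J lam mu y) (\<lambda>_. True) b"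

definition cone_const :: "real ^ 'p ^ 'd \<Rightarrow> real ^ 'p \<Rightarrow> real \<Rightarrow> real \<Rightarrow> real" where
  "cone_const J beta lam mu =
     4 * sqrt (real (card (sparsity_set beta))) + 4 * mu / lam * norm (J_tilde J *v beta)"

definition restricted_eigenvalue ::
  "real ^ 'p ^ 'p \<Rightarrow> 'p set \<Rightarrow> real \<Rightarrow> real \<Rightarrow> bool" where
  "restricted_eigenvalue K B rho phi \<longleftrightarrow>
     phi > 0 \<and>
     (\<forall>\<Delta>. (\<Sum>j\<in>- B. \<bar>\<Delta> $ j\<bar>) \<le> rho * sqrt (\<Sum>j\<in>B. (\<Delta> $ j)\<^sup>2)
        \<longrightarrow> \<Delta> \<bullet> (K *v \<Delta>) \<ge> phi * (\<Sum>j\<in>B. (\<Delta> $ j)\<^sup>2))"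

(* Inner probability: no measurability of P is needed, so an arbitrary choice of minimisers is
   allowed as the estimator. For events this is the usual notion (next lemma). *)
definition with_prob_gt :: "'w measure \<Rightarrow> real \<Rightarrow> ('w \<Rightarrow> bool) \<Rightarrow> bool" where
  "with_prob_gt M c P \<longleftrightarrow> (\<exists>E\<in>sets M. (\<forall>\<omega>\<in>E. P \<omega>) \<and> measure M E > c)"

lemma (in prob_space) with_prob_gt_iff_prob:
  assumes "{\<omega> \<in> space M. P \<omega>} \<in> events"
  shows "with_prob_gt M c P \<longleftrightarrow> prob {\<omega> \<in> space M. P \<omega>} > c"
proof
  assume "with_prob_gt M c P"
  then obtain E where E: "E \<in> events" "\<forall>\<omega>\<in>E. P \<omega>" "c < prob E"
    by (auto simp: with_prob_gt_def)
  have "E \<subseteq> {\<omega> \<in> space M. P \<omega>}"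
    using E(2) sets.sets_into_space[OF E(1)] by auto
  then have "prob E \<le> prob {\<omega> \<in> space M. P \<omega>}"
    using assms by (rule finite_measure_mono)
  with E(3) show "c < prob {\<omega> \<in> space M. P \<omega>}"
    by (rule less_le_trans)
next
  assume "c < prob {\<omega> \<in> space M. P \<omega>}"
  then show "with_prob_gt M c P"
    unfolding with_prob_gt_def by (intro bexI[OF _ assms] conjI ballI) auto
qed

end

theory Submission
  imports Defs
begin

text \<open>
  The probabilistic and the deterministic part separate. Let $d = \hat\beta - \beta^*$, let
  $D = d' K_n d$, and let $x$ be the $\ell_2$ norm of $d$ on the set $B$.

  Each score $\sum_i X_{ij} \varepsilon_i$ is a centred Gaussian of variance at most
  $n \sigma^2$. With the given $\lambda_n$, a union bound over the $p$ columns shows that all scores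
  are at most $n \lambda_n / 4$ in absolute value on an event of probability greater than
  $1 - \eta$ (\<open>noise_event\<close>). The inequality is strict because the Gaussian tail bound
  $P(|Z| > t) < \exp(-t^2 / (2 v^2))$ is (\<open>gaussian_tail_less\<close>). This event does not involve the
  estimator, so the same event serves the quadratic estimator and the Lasso.

  On this event everything is algebra (\<open>quad_estimator_bounds\<close>). Comparing the criterion at
  $\hat\beta$ and at $\beta^*$ gives
  $D + \frac{\lambda_n}{2} |d|_1 \le \frac{\lambda_n \varrho_n}{2} x$; here the penalty
  contributes the inner product of $d$ with $\widetilde J \beta^*$, and Cauchy-Schwarz on $B$ applies
  to it since $\widetilde J \beta^*$ is supported in $B$. As $D \ge 0$, this inequality puts $d$ in the
  cone of the restricted-eigenvalue condition, so $\phi x^2 \le D$. Eliminating $x$ yields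
  $D \le \lambda_n^2 \varrho_n^2 / (4 \phi)$ and
  $|d|_1 \le \lambda_n \varrho_n^2 / (8 \phi)$.

  The second bound comes from maximising $\frac{\lambda_n \varrho_n}{2} x - \phi x^2$ over $x$. It is
  smaller by a factor $4$ than the bound obtained from $|d|_1 \le \varrho_n x$ and
  $x \le \lambda_n \varrho_n / (2 \phi)$, which is the one displayed in part (1). The constant $36$
  of part (2) depends on this gain: from the displayed bound of part (1) and $\phi \ge \sqrt{\mu_n}$ one
  only gets $18 \sqrt{8 \sqrt 2} \approx 60.5$, whereas the sharper bound gives a quarter of that.
\<close>

section \<open>The basic inequality\<close>

lemma emp_norm_power2:
  "(emp_norm (a :: real ^ 'n))\<^sup>2 = (a \<bullet> a) / real CARD('n)"
  unfolding emp_norm_def inner_vec_def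
  by (subst real_sqrt_pow2) (auto intro!: divide_nonneg_nonneg sum_nonneg simp: power2_eq_square)

lemma inner_transpose_mult:
  fixes A :: "real ^ 'p ^ 'n"
  shows "v \<bullet> ((transpose A ** A) *v w) = (A *v v) \<bullet> (A *v w)"
  by (metis dot_lmul_matrix matrix_vector_mul_assoc transpose_matrix_vector inner_commute)

lemma inner_J_tilde: "v \<bullet> (J_tilde J *v w) = (J *v v) \<bullet> (J *v w)"
  by (simp add: J_tilde_def inner_transpose_mult)

lemma inner_ext_gram:
  "v \<bullet> (ext_gram X J mu *v v) = (emp_norm (X *v v))\<^sup>2 + mu * (v \<bullet> (J_tilde J *v v))"
  by (simp add: ext_gram_def gram_def matrix_vector_mult_add_rdistrib inner_add_right
      scaleR_matrix_vector_assoc [symmetric] inner_transpose_mult emp_norm_power2)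

lemma emp_norm_le_ext_gram:
  assumes "mu \<ge> 0"
  shows "(emp_norm (X *v v))\<^sup>2 \<le> v \<bullet> (ext_gram X J mu *v v)"
  using assms by (simp add: inner_ext_gram inner_J_tilde)

text \<open>
  Comparing the criterion at the minimiser \<open>b\<close> and at \<open>beta\<close>. The quadratic penalty is expanded around
  \<open>beta\<close>: its second-order part joins the loss to form the extended Gram matrix, and its
  first-order part is the bias term of the last line.
\<close>
lemma basic_inequality:
  fixes X :: "real ^ 'p ^ 'n"
  assumes "is_quad_estimator X J lam mu (X *v beta + e) b"
  shows "(b - beta) \<bullet> (ext_gram X J mu *v (b - beta))
    \<le> 2 / real CARD('n) * (e \<bullet> (X *v (b - beta))) + lam * (l1_norm beta - l1_norm b)
      - 2 * mu * ((b - beta) \<bullet> (J_tilde J *v beta))"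
proof -
  define d where "d = b - beta"
  have b: "b = beta + d" by (simp add: d_def)
  define N where "N = real CARD('n)"
  have le: "quad_criterion X J lam mu (X *v beta + e) b
      \<le> quad_criterion X J lam mu (X *v beta + e) beta"
    using assms by (auto simp: is_quad_estimator_def is_arg_min_def not_less)
  have res: "X *v beta + e - X *v b = e - X *v d"
    by (simp add: b matrix_vector_right_distrib)
  have fit: "(emp_norm (e - X *v d))\<^sup>2
      = (emp_norm e)\<^sup>2 - 2 / N * (e \<bullet> (X *v d)) + (emp_norm (X *v d))\<^sup>2"
    by (simp add: emp_norm_power2 N_def [symmetric] inner_diff_left inner_diff_right inner_commute
        add_divide_distrib diff_divide_distrib)
  have pen: "b \<bullet> (J_tilde J *v b) = beta \<bullet> (J_tilde J *v beta)
      + 2 * (d \<bullet> (J_tilde J *v beta)) + d \<bullet> (J_tilde J *v d)"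
    by (simp add: b inner_J_tilde matrix_vector_right_distrib inner_add_left inner_add_right
        inner_commute)
  show ?thesis
    using le unfolding quad_criterion_def res fit pen d_def [symmetric] N_def [symmetric]
    by (simp add: inner_ext_gram algebra_simps)
qed

section \<open>Bounding the terms of the basic inequality\<close>

lemma sum_mult_le_l2:
  fixes f g :: "'a \<Rightarrow> real"
  assumes "finite S"
  shows "\<bar>\<Sum>j\<in>S. f j * g j\<bar> \<le> sqrt (\<Sum>j\<in>S. (f j)\<^sup>2) * sqrt (\<Sum>j\<in>S. (g j)\<^sup>2)"
proof -
  have "\<bar>\<Sum>j\<in>S. f j * g j\<bar> \<le> (\<Sum>j\<in>S. \<bar>f j\<bar> * \<bar>g j\<bar>)"
    by (metis (no_types, lifting) abs_mult sum_abs sum.cong)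
  also have "\<dots> \<le> L2_set f S * L2_set g S" by (rule L2_set_mult_ineq)
  finally show ?thesis by (simp add: L2_set_def)
qed

text \<open>Duality of $\ell_1$ and $\ell_\infty$: bounding the scores of the single columns controls the
  noise in every direction \<open>d\<close>.\<close>
lemma noise_inner_le:
  fixes X :: "real ^ 'p ^ 'n"
  assumes "\<And>j. \<bar>e \<bullet> column j X\<bar> \<le> T"
  shows "e \<bullet> (X *v d) \<le> T * l1_norm d"
proof -
  have "e \<bullet> (X *v d) = (\<Sum>j\<in>UNIV. d $ j * (e \<bullet> column j X))"
    by (simp add: matrix_mult_sum inner_sum_right scalar_mult_eq_scaleR)
  also have "\<dots> \<le> (\<Sum>j\<in>UNIV. T * \<bar>d $ j\<bar>)"
  proof (rule sum_mono)
    fix j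
    have "d $ j * (e \<bullet> column j X) \<le> \<bar>d $ j\<bar> * \<bar>e \<bullet> column j X\<bar>"
      by (metis abs_ge_self abs_mult)
    also have "\<dots> \<le> \<bar>d $ j\<bar> * T"
      by (intro mult_left_mono assms) simp
    finally show "d $ j * (e \<bullet> column j X) \<le> T * \<bar>d $ j\<bar>" by (simp add: mult.commute)
  qed
  finally show ?thesis by (simp add: l1_norm_def sum_distrib_left)
qed

text \<open>Off the support of \<open>beta\<close> the three terms cancel, and on it the triangle inequality applies.
  This is how sparsity enters.\<close>
lemma l1_norm_sparse_cancel:
  fixes beta b :: "real ^ 'p"
  shows "l1_norm (b - beta) + l1_norm beta - l1_norm b
    \<le> 2 * (\<Sum>j\<in>sparsity_set beta. \<bar>(b - beta) $ j\<bar>)"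
proof -
  have "l1_norm (b - beta) + l1_norm beta - l1_norm b
      = (\<Sum>j\<in>UNIV. \<bar>(b - beta) $ j\<bar> + \<bar>beta $ j\<bar> - \<bar>b $ j\<bar>)"
    by (simp add: l1_norm_def sum.distrib sum_subtractf)
  also have "\<dots> \<le> (\<Sum>j\<in>UNIV. if j \<in> sparsity_set beta then 2 * \<bar>(b - beta) $ j\<bar> else 0)"
    by (rule sum_mono) (auto simp: sparsity_set_def)
  finally show ?thesis
    by (simp add: sum.If_cases sum_distrib_left)
qed

lemma inner_supported_le:
  fixes v w :: "real ^ 'p"
  assumes "sparsity_set w \<subseteq> B"
  shows "\<bar>v \<bullet> w\<bar> \<le> sqrt (\<Sum>j\<in>B. (v $ j)\<^sup>2) * norm w"
proof -
  have "v \<bullet> w = (\<Sum>j\<in>B. v $ j * w $ j)"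
    unfolding inner_vec_def inner_real_def using assms
    by (intro sum.mono_neutral_right) (auto simp: sparsity_set_def)
  also have "\<bar>\<dots>\<bar> \<le> sqrt (\<Sum>j\<in>B. (v $ j)\<^sup>2) * sqrt (\<Sum>j\<in>B. (w $ j)\<^sup>2)"
    by (rule sum_mult_le_l2) simp
  also have "\<dots> \<le> sqrt (\<Sum>j\<in>B. (v $ j)\<^sup>2) * norm w"
    by (intro mult_left_mono)
      (auto simp: norm_vec_def L2_set_def intro!: sum_mono2 sum_nonneg)
  finally show ?thesis .
qed

lemma l1_on_subset_le:
  fixes v :: "real ^ 'p"
  assumes "S \<subseteq> B"
  shows "(\<Sum>j\<in>S. \<bar>v $ j\<bar>) \<le> sqrt (real (card S)) * sqrt (\<Sum>j\<in>B. (v $ j)\<^sup>2)"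
proof -
  have "(\<Sum>j\<in>S. \<bar>v $ j\<bar>) \<le> sqrt (\<Sum>j\<in>S. 1\<^sup>2) * sqrt (\<Sum>j\<in>S. \<bar>v $ j\<bar>\<^sup>2)"
    using sum_mult_le_l2[of S "\<lambda>_. 1" "\<lambda>j. \<bar>v $ j\<bar>"] by simp
  also have "\<dots> \<le> sqrt (real (card S)) * sqrt (\<Sum>j\<in>B. (v $ j)\<^sup>2)"
    using assms by (intro mult_mono) (auto intro!: sum_mono2 sum_nonneg)
  finally show ?thesis .
qed

section \<open>Deterministic error bounds\<close>

text \<open>
  The elimination of the norm \<open>x\<close>. The bound on \<open>l\<close> is $a x - \phi x^2 \le a^2 / (4 \phi)$. In the
  bound on \<open>D\<close>, \<open>D\<close> occurs on both sides of $\phi x^2 \le D \le a x$, which forces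
  $\phi x \le a$ when $x > 0$.
\<close>
lemma scalar_bounds:
  fixes D x l a phi lam :: real
  assumes main: "D + lam / 2 * l \<le> a * x" and re: "phi * x\<^sup>2 \<le> D"
    and pos: "phi > 0" "lam > 0" "l \<ge> 0"
  shows "D \<le> a\<^sup>2 / phi" and "l \<le> a\<^sup>2 / (2 * phi * lam)"
proof -
  have D: "D \<le> a * x" using main pos by (smt (verit) divide_nonneg_nonneg mult_nonneg_nonneg)
  have "0 \<le> (2 * phi * x - a)\<^sup>2" by simp
  then have "4 * phi * (a * x) - 4 * phi * (phi * x\<^sup>2) \<le> a\<^sup>2"
    by (simp add: power2_eq_square algebra_simps)
  moreover have "4 * phi * (phi * x\<^sup>2) \<le> 4 * phi * D" "4 * phi * (D + lam / 2 * l) \<le> 4 * phi * (a * x)"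
    using main re pos by (auto intro!: mult_left_mono)
  ultimately have "4 * phi * (lam / 2 * l) \<le> a\<^sup>2" by (simp add: algebra_simps)
  then show "l \<le> a\<^sup>2 / (2 * phi * lam)" using pos by (simp add: field_simps)
  have xD: "phi * x\<^sup>2 \<le> a * x" using re D by simp
  have "(phi * x - a) * (phi * x) \<le> 0"
    using mult_left_mono[OF xD, of phi] pos by (simp add: power2_eq_square algebra_simps)
  moreover have "(phi * x - a)\<^sup>2 \<ge> 0" by simp
  ultimately have "a * (phi * x) \<le> a\<^sup>2" by (simp add: power2_eq_square algebra_simps)
  moreover have "D * phi \<le> a * x * phi" using D pos by (intro mult_right_mono) auto
  ultimately have "D * phi \<le> a\<^sup>2" by (simp add: mult_ac)
  then show "D \<le> a\<^sup>2 / phi" using pos by (simp add: pos_le_divide_eq)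
qed

text \<open>
  The level $n \lambda / 4$ for the scores is chosen so that the noise term is at most
  $\frac{\lambda}{2} |d|_1$. Adding another $\frac{\lambda}{2} |d|_1$ to both sides of the basic
  inequality then leaves $\lambda (|d|_1 + |\beta^*|_1 - |\hat\beta|_1)$ on the right, which lives on
  the support of $\beta^*$ only, and keeps an $\ell_1$ term on the left. That term gives
  both the cone condition and the $\ell_1$ bound.
\<close>
lemma quad_estimator_bounds:
  fixes X :: "real ^ 'p ^ 'n"
  assumes est: "is_quad_estimator X J lam mu (X *v beta + e) b"
    and noise: "\<And>j. \<bar>e \<bullet> column j X\<bar> \<le> real CARD('n) * lam / 4"
    and lam: "lam > 0" and mu: "mu \<ge> 0"
    and A: "sparsity_set beta \<subseteq> B" and JB: "sparsity_set (J_tilde J *v beta) \<subseteq> B"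
    and RE: "restricted_eigenvalue (ext_gram X J mu) B (cone_const J beta lam mu) phi"
  shows "(emp_norm (X *v beta - X *v b))\<^sup>2 \<le> lam\<^sup>2 * (cone_const J beta lam mu)\<^sup>2 / (4 * phi)"
    and "l1_norm (beta - b) \<le> lam * (cone_const J beta lam mu)\<^sup>2 / (8 * phi)"
proof -
  define d where "d = b - beta"
  define D where "D = d \<bullet> (ext_gram X J mu *v d)"
  define x where "x = sqrt (\<Sum>j\<in>B. (d $ j)\<^sup>2)"
  define rho where "rho = cone_const J beta lam mu"
  have phi: "phi > 0" using RE by (simp add: restricted_eigenvalue_def)
  have l1: "0 \<le> l1_norm d" by (simp add: l1_norm_def sum_nonneg)
  have DX: "(emp_norm (X *v d))\<^sup>2 \<le> D"
    unfolding D_def by (rule emp_norm_le_ext_gram[OF mu])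
  have D0: "0 \<le> D" using DX by (rule order_trans[rotated]) simp
  have n: "2 / real CARD('n) * (e \<bullet> (X *v d)) \<le> lam / 2 * l1_norm d"
    using mult_left_mono[OF noise_inner_le[OF noise, of d], of "2 / real CARD('n)"] by simp
  have "D \<le> 2 / real CARD('n) * (e \<bullet> (X *v d)) + lam * (l1_norm beta - l1_norm b)
      - 2 * mu * (d \<bullet> (J_tilde J *v beta))"
    using basic_inequality[OF est] by (simp add: D_def d_def)
  moreover have "- (2 * mu * (d \<bullet> (J_tilde J *v beta))) \<le> 2 * mu * (x * norm (J_tilde J *v beta))"
    using mult_left_mono[OF inner_supported_le[OF JB, of d], of "2 * mu"] mu
    by (smt (verit) x_def mult_left_mono mult_minus_right)
  ultimately have "D + lam / 2 * l1_norm d \<le> lam * (l1_norm d + l1_norm beta - l1_norm b)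
      + 2 * mu * (x * norm (J_tilde J *v beta))"
    using n unfolding right_diff_distrib distrib_left by linarith
  also have "lam * (l1_norm d + l1_norm beta - l1_norm b)
      \<le> lam * (2 * (sqrt (real (card (sparsity_set beta))) * x))"
    using l1_norm_sparse_cancel[of b beta] l1_on_subset_le[OF A, of d] lam
    by (intro mult_left_mono) (auto simp: d_def x_def)
  finally have "D + lam / 2 * l1_norm d \<le> lam * (2 * (sqrt (real (card (sparsity_set beta))) * x))
      + 2 * mu * (x * norm (J_tilde J *v beta))"
    by simp
  also have "\<dots> = (lam * rho / 2) * x"
    using lam by (simp add: rho_def cone_const_def field_simps)
  finally have main: "D + lam / 2 * l1_norm d \<le> (lam * rho / 2) * x" .
  have "lam / 2 * l1_norm d \<le> lam / 2 * (rho * x)"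
    using main D0 by (simp add: algebra_simps)
  then have cone: "l1_norm d \<le> rho * x"
    using lam by simp
  have "(\<Sum>j\<in>- B. \<bar>d $ j\<bar>) \<le> l1_norm d"
    unfolding l1_norm_def by (rule sum_mono2) auto
  with cone have "(\<Sum>j\<in>- B. \<bar>d $ j\<bar>) \<le> rho * sqrt (\<Sum>j\<in>B. (d $ j)\<^sup>2)"
    by (simp add: x_def)
  then have "phi * (\<Sum>j\<in>B. (d $ j)\<^sup>2) \<le> D"
    using RE by (simp add: restricted_eigenvalue_def rho_def D_def)
  then have re: "phi * x\<^sup>2 \<le> D"
    by (simp add: x_def sum_nonneg)
  note bounds = scalar_bounds[OF main re phi lam l1]
  have "X *v beta - X *v b = - (X *v d)"
    by (simp add: d_def matrix_vector_mult_diff_distrib)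
  then have "(emp_norm (X *v beta - X *v b))\<^sup>2 = (emp_norm (X *v d))\<^sup>2"
    by (simp add: emp_norm_def)
  also have "\<dots> \<le> (lam * rho / 2)\<^sup>2 / phi" using DX bounds(1) by (rule order_trans)
  finally show "(emp_norm (X *v beta - X *v b))\<^sup>2 \<le> lam\<^sup>2 * (cone_const J beta lam mu)\<^sup>2 / (4 * phi)"
    by (simp add: rho_def power_mult_distrib power_divide)
  have "l1_norm (beta - b) = l1_norm d" by (simp add: l1_norm_def d_def abs_minus_commute)
  also have "\<dots> \<le> (lam * rho / 2)\<^sup>2 / (2 * phi * lam)" by (rule bounds(2))
  also have "\<dots> = lam * (cone_const J beta lam mu)\<^sup>2 / (8 * phi)"
    using lam by (simp add: rho_def power2_eq_square)
  finally show "l1_norm (beta - b) \<le> lam * (cone_const J beta lam mu)\<^sup>2 / (8 * phi)" .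
qed

section \<open>The Gaussian tail\<close>

text \<open>Shifting the density outwards by \<open>t\<close> multiplies it by a factor that is less than
  $\exp(-t^2/(2 v^2))$ at every point $x \ne 0$ when $t > 0$.\<close>
lemma gaussian_tail_factor:
  fixes v t x :: real
  assumes "v > 0"
  shows "normal_density 0 v (\<bar>x\<bar> + t)
    = normal_density 0 v x * (exp (- t\<^sup>2 / (2 * v\<^sup>2)) * exp (- (t * \<bar>x\<bar> / v\<^sup>2)))"
proof -
  have "(\<bar>x\<bar> + t)\<^sup>2 / (2 * v\<^sup>2) = x\<^sup>2 / (2 * v\<^sup>2) + t\<^sup>2 / (2 * v\<^sup>2) + t * \<bar>x\<bar> / v\<^sup>2"
    using assms by (simp add: power2_sum field_simps)
  then have "exp (- (\<bar>x\<bar> + t)\<^sup>2 / (2 * v\<^sup>2))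
      = exp (- x\<^sup>2 / (2 * v\<^sup>2)) * (exp (- t\<^sup>2 / (2 * v\<^sup>2)) * exp (- (t * \<bar>x\<bar> / v\<^sup>2)))"
    by (simp add: exp_add [symmetric])
  then show ?thesis by (simp add: normal_density_def)
qed

lemma normal_density_even: "normal_density 0 v (- x) = normal_density 0 v x"
  by (simp add: normal_density_def)

text \<open>
  Translating the two half-lines $x > t$ and $x < -t$ inwards by \<open>t\<close> maps them onto the positive and the
  negative half-line. By the factorisation of the shifted density the tail probability becomes the
  expectation of a function of \<open>Z\<close> that is almost surely less than $\exp(-t^2/(2 v^2))$. Treating both tails
  at once gives the constant $1$ in front of the exponential.
\<close>
lemma (in prob_space) gaussian_tail_less:
  assumes Z: "distributed M lborel Z (normal_density 0 v)" and v: "v > 0" and t: "t > 0"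
  shows "prob {\<omega> \<in> space M. \<bar>Z \<omega>\<bar> > t} < exp (- t\<^sup>2 / (2 * v\<^sup>2))"
proof -
  let ?f = "normal_density 0 v"
  let ?c = "exp (- t\<^sup>2 / (2 * v\<^sup>2))"
  \<comment> \<open>\<open>h\<close> is the ratio of the shifted density to the density; \<open>u\<close> and \<open>w\<close> are the right and the left
    tail after translation.\<close>
  define h where "h x = ?c * exp (- (t * \<bar>x\<bar> / v\<^sup>2))" for x
  define u where "u x = indicator {0<..} x * ?f (t + x)" for x :: real
  define w where "w x = indicator {..<0} x * ?f (- t + x)" for x :: real
  have [measurable]: "Z \<in> borel_measurable M"
    using distributed_measurable[OF Z] by simp
  have f[measurable]: "?f \<in> borel_measurable borel" by simp
  have h[measurable]: "h \<in> borel_measurable borel" unfolding h_def by measurable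
  have int_shift: "integrable lborel (\<lambda>x. ?f (s + x))" for s
    using lborel_integrable_real_affine[OF integrable_normal_density[OF v], of 1 0 s] by simp
  have int_u: "integrable lborel u" and int_w: "integrable lborel w"
    unfolding u_def w_def mult.commute[of "indicator _ _"]
    by (intro integrable_real_mult_indicator int_shift; simp)+
  have int_ind: "integrable lborel (\<lambda>x. ?f x * indicator S x)" if "S \<in> sets borel" for S
    using that v by (intro integrable_real_mult_indicator) auto
  have "prob {\<omega> \<in> space M. \<bar>Z \<omega>\<bar> > t} = (\<integral>\<omega>. indicator {x. \<bar>x\<bar> > t} (Z \<omega>) \<partial>M)"
  proof -
    have "(\<integral>\<omega>. indicat_real {x. \<bar>x\<bar> > t} (Z \<omega>) \<partial>M)
        = (\<integral>\<omega>. indicator {\<omega> \<in> space M. \<bar>Z \<omega>\<bar> > t} \<omega> \<partial>M)"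
      by (intro Bochner_Integration.integral_cong) (auto simp: indicator_def)
    then show ?thesis by (simp add: Int_def conj_ac)
  qed
  also have "\<dots> = (\<integral>x. ?f x * indicator {x. \<bar>x\<bar> > t} x \<partial>lborel)"
    by (rule distributed_integral[OF Z, symmetric]) auto
  also have "\<dots> = (\<integral>x. ?f x * indicator {t<..} x + ?f x * indicator {..<-t} x \<partial>lborel)"
    using t by (intro Bochner_Integration.integral_cong) (auto simp: indicator_def)
  also have "\<dots> = (\<integral>x. ?f x * indicator {t<..} x \<partial>lborel) + (\<integral>x. ?f x * indicator {..<-t} x \<partial>lborel)"
    by (intro Bochner_Integration.integral_add int_ind) auto
  also have "(\<integral>x. ?f x * indicator {t<..} x \<partial>lborel) = (\<integral>x. u x \<partial>lborel)"
    by (subst lborel_integral_real_affine[where c=1 and t=t])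
      (auto intro!: Bochner_Integration.integral_cong simp: u_def indicator_def)
  also have "(\<integral>x. ?f x * indicator {..<-t} x \<partial>lborel) = (\<integral>x. w x \<partial>lborel)"
    by (subst lborel_integral_real_affine[where c=1 and t="-t"])
      (auto intro!: Bochner_Integration.integral_cong simp: w_def indicator_def)
  also have "(\<integral>x. u x \<partial>lborel) + (\<integral>x. w x \<partial>lborel) = (\<integral>x. u x + w x \<partial>lborel)"
    by (intro Bochner_Integration.integral_add [symmetric] int_u int_w)
  also have "\<dots> = (\<integral>x. ?f x * h x \<partial>lborel)"
  proof (intro integral_cong_AE)
    show "AE x in lborel. u x + w x = ?f x * h x"
      using AE_lborel_singleton[of 0]
    proof eventually_elim
      case (elim x)
      show ?case
      proof (cases "x > 0")
        case True
        then show ?thesis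
          using gaussian_tail_factor[OF v, of x t] by (simp add: u_def w_def h_def add.commute)
      next
        case False
        with elim have "x < 0" by simp
        then show ?thesis
          using gaussian_tail_factor[OF v, of x t] normal_density_even[of v "-t + x"]
          by (simp add: u_def w_def h_def add.commute)
      qed
    qed
  qed (auto simp: u_def w_def)
  also have "\<dots> = (\<integral>\<omega>. h (Z \<omega>) \<partial>M)"
    by (rule distributed_integral[OF Z]) auto
  also have "\<dots> < (\<integral>\<omega>. ?c \<partial>M)"
  proof (rule integral_less_AE_space)
    have bnd: "0 \<le> h x" "h x \<le> ?c" for x
      using t by (auto simp: h_def mult_le_cancel_left1)
    show "integrable M (\<lambda>\<omega>. h (Z \<omega>))"
      using bnd by (intro integrable_const_bound[where B="?c"]) auto
    have "AE x in lborel. ennreal (?f x) \<noteq> 0 \<longrightarrow> x \<noteq> 0"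
      using AE_lborel_singleton[of 0] by eventually_elim simp
    then have "AE x in density lborel ?f. x \<noteq> 0"
      by (subst AE_density) (auto elim: eventually_mono)
    then have "AE x in distr M lborel Z. x \<noteq> 0"
      unfolding distributed_distr_eq_density[OF Z] .
    then have "AE \<omega> in M. Z \<omega> \<noteq> 0"
      by (subst (asm) AE_distr_iff) auto
    then show "AE \<omega> in M. h (Z \<omega>) < ?c"
      by eventually_elim (use t v in \<open>simp add: h_def\<close>)
  qed (auto simp: emeasure_space_1)
  finally show ?thesis by (simp add: prob_space)
qed

section \<open>The noise event\<close>

text \<open>The bound \<open>V\<close> on the sum of squares need not be attained, so that one tail estimate covers all
  columns of the design, among them possible zero columns, whose score has no density.\<close>
lemma (in prob_space) gaussian_combination_tail_less:
  fixes eps :: "'n :: finite \<Rightarrow> 'a \<Rightarrow> real" and a :: "'n \<Rightarrow> real"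
  assumes indep: "indep_vars (\<lambda>_. borel) eps UNIV"
    and normal: "\<And>i. distributed M lborel (eps i) (normal_density 0 \<sigma>)"
    and \<sigma>: "\<sigma> > 0" and t: "t > 0" and V: "(\<Sum>i\<in>UNIV. (a i)\<^sup>2) \<le> V"
  shows "prob {\<omega> \<in> space M. \<bar>\<Sum>i\<in>UNIV. a i * eps i \<omega>\<bar> > t} < exp (- t\<^sup>2 / (2 * \<sigma>\<^sup>2 * V))"
proof -
  \<comment> \<open>Summands with a vanishing coefficient are constant and have no normal density.\<close>
  define I where "I = {i. a i \<noteq> 0}"
  have sum_I: "(\<Sum>i\<in>UNIV. a i * eps i \<omega>) = (\<Sum>i\<in>I. a i * eps i \<omega>)" for \<omega>
    by (rule sum.mono_neutral_right) (auto simp: I_def)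
  show ?thesis
  proof (cases "I = {}")
    case True
    then show ?thesis using t by (simp add: sum_I)
  next
    case False
    define v where "v = sqrt (\<Sum>i\<in>I. (\<bar>a i\<bar> * \<sigma>)\<^sup>2)"
    have I_sq: "(\<Sum>i\<in>I. (a i)\<^sup>2) = (\<Sum>i\<in>UNIV. (a i)\<^sup>2)"
      by (rule sum.mono_neutral_left) (auto simp: I_def)
    have pos: "(\<Sum>i\<in>I. (\<bar>a i\<bar> * \<sigma>)\<^sup>2) > 0"
      using False \<sigma> by (intro sum_pos) (auto simp: I_def)
    then have v: "v > 0" by (simp add: v_def)
    have v2: "v\<^sup>2 \<le> \<sigma>\<^sup>2 * V"
      using pos V by (simp add: v_def power_mult_distrib sum_distrib_right [symmetric] I_sq
          mult.commute[of "\<sigma>\<^sup>2"] mult_right_mono)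
    have "distributed M lborel (\<lambda>\<omega>. \<Sum>i\<in>I. a i * eps i \<omega>)
        (normal_density (\<Sum>i\<in>I. 0) (sqrt (\<Sum>i\<in>I. (\<bar>a i\<bar> * \<sigma>)\<^sup>2)))"
    proof (rule sum_indep_normal)
      show "indep_vars (\<lambda>i. borel) (\<lambda>i \<omega>. a i * eps i \<omega>) I"
        using indep_vars_compose2[OF indep_vars_subset[OF indep], of I "\<lambda>i x. a i * x" "\<lambda>_. borel"]
        by simp
      show "distributed M lborel (\<lambda>\<omega>. a i * eps i \<omega>) (normal_density 0 (\<bar>a i\<bar> * \<sigma>))" if "i \<in> I" for i
        using normal_density_affine[OF normal[of i] \<sigma>, of "a i" 0] that by (simp add: I_def)
    qed (use False \<sigma> in \<open>auto simp: I_def\<close>)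
    then have Z: "distributed M lborel (\<lambda>\<omega>. \<Sum>i\<in>I. a i * eps i \<omega>) (normal_density 0 v)"
      by (simp add: v_def)
    have "prob {\<omega> \<in> space M. \<bar>\<Sum>i\<in>I. a i * eps i \<omega>\<bar> > t} < exp (- t\<^sup>2 / (2 * v\<^sup>2))"
      by (rule gaussian_tail_less[OF Z v t])
    also have "\<dots> \<le> exp (- t\<^sup>2 / (2 * (\<sigma>\<^sup>2 * V)))"
    proof -
      have v2_pos: "0 < 2 * v\<^sup>2" using v by simp
      then have V_pos: "0 < 2 * (\<sigma>\<^sup>2 * V)" using v2 by linarith
      note prod = mult_pos_pos[OF V_pos v2_pos]
      then have "t\<^sup>2 / (2 * (\<sigma>\<^sup>2 * V)) \<le> t\<^sup>2 / (2 * v\<^sup>2)"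
        using v2 by (intro divide_left_mono[OF _ _ prod]) simp_all
      then show ?thesis by simp
    qed
    finally show ?thesis by (simp add: sum_I mult.assoc)
  qed
qed

text \<open>The threshold \<open>T\<close> is the one for which the tail bound $\exp(-T^2 / (2 \sigma^2 n))$ of a single
  score equals $\eta / p$.\<close>
lemma (in prob_space) noise_event:
  fixes X :: "real ^ 'p ^ 'n" and eps :: "'n \<Rightarrow> 'a \<Rightarrow> real"
  assumes indep: "indep_vars (\<lambda>_. borel) eps UNIV"
    and normal: "\<And>i. distributed M lborel (eps i) (normal_density 0 \<sigma>)"
    and \<sigma>: "\<sigma> > 0" and cols: "\<And>j. emp_norm (column j X) \<le> 1"
    and \<eta>: "0 < \<eta>" "\<eta> < 1"
  shows "with_prob_gt M (1 - \<eta>) (\<lambda>\<omega>. \<forall>j. \<bar>(\<chi> i. eps i \<omega>) \<bullet> column j X\<bar>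
    \<le> real CARD('n) * (sqrt 2 * \<sigma> * sqrt (ln (real CARD('p) / \<eta>) / real CARD('n))))"
proof -
  define n where "n = real CARD('n)"
  define p where "p = real CARD('p)"
  define T where "T = n * (sqrt 2 * \<sigma> * sqrt (ln (p / \<eta>) / n))"
  define F where "F j = {\<omega> \<in> space M. \<bar>\<Sum>i\<in>UNIV. X $ i $ j * eps i \<omega>\<bar> > T}" for j
  have n: "n > 0" by (simp add: n_def)
  have p: "p \<ge> 1" by (simp add: p_def Suc_le_eq)
  have "p / \<eta> > 1" using p \<eta> by simp
  then have ln: "ln (p / \<eta>) > 0" by simp
  have T: "T > 0" using \<sigma> n ln by (simp add: T_def)
  have [measurable]: "eps i \<in> borel_measurable M" for i
    using distributed_measurable[OF normal[of i]] by simp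
  have F: "F j \<in> events" for j unfolding F_def by measurable
  have "(\<Sum>i\<in>UNIV. (X $ i $ j)\<^sup>2) \<le> n" for j
    using cols[of j] by (simp add: emp_norm_def column_def n_def)
  from gaussian_combination_tail_less[OF indep normal \<sigma> T this]
  have "prob (F j) < exp (- T\<^sup>2 / (2 * \<sigma>\<^sup>2 * n))" for j
    by (simp add: F_def)
  moreover have "T\<^sup>2 / (2 * \<sigma>\<^sup>2 * n) = ln (p / \<eta>)"
    using \<sigma> n ln by (simp add: T_def power_mult_distrib) (simp add: power2_eq_square)
  then have "exp (- T\<^sup>2 / (2 * \<sigma>\<^sup>2 * n)) = \<eta> / p"
    using \<eta> p by (simp add: exp_minus)
  ultimately have Fj: "prob (F j) < \<eta> / p" for j by simp
  have "prob (\<Union>j\<in>UNIV. F j) \<le> (\<Sum>j\<in>UNIV. prob (F j))"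
    using F by (intro finite_measure_subadditive_finite) auto
  also have "\<dots> < (\<Sum>j\<in>(UNIV :: 'p set). \<eta> / p)"
    using Fj by (intro sum_strict_mono) auto
  also have "\<dots> = \<eta>" by (simp add: p_def)
  finally have "prob (\<Union>j\<in>UNIV. F j) < \<eta>" .
  then have "prob (space M - (\<Union>j\<in>UNIV. F j)) > 1 - \<eta>"
    using F by (subst prob_compl) auto
  moreover have "(\<chi> i. eps i \<omega>) \<bullet> column j X = (\<Sum>i\<in>UNIV. X $ i $ j * eps i \<omega>)" for \<omega> j
    by (simp add: inner_vec_def column_def mult.commute)
  ultimately show ?thesis
    unfolding with_prob_gt_def T_def [symmetric, unfolded n_def p_def] 
    using F by (intro bexI[where x="space M - (\<Union>j\<in>UNIV. F j)"]) (auto simp: F_def not_less)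
qed

section \<open>Error bounds with high probability\<close>

lemma with_prob_gt_mono:
  assumes "with_prob_gt M c P" and "\<And>\<omega>. \<omega> \<in> space M \<Longrightarrow> P \<omega> \<Longrightarrow> Q \<omega>"
  shows "with_prob_gt M c Q"
  using assms sets.sets_into_space unfolding with_prob_gt_def by blast

text \<open>
  For the given $\mu_n$ the constant $\varrho_n$ is $6 \sqrt s$, and it is $4 \sqrt s$ for the Lasso, so the
  Lasso obeys the same bounds with room to spare. In terms of $\lambda_n$ the right-hand sides of part
  (1) are $9 \lambda_n^2 s / \phi$ and $18 \lambda_n s / \phi$; with $\phi_0 < \lambda_n^2 s$
  they exceed $9$ and $18 / \lambda_n$ for the Lasso. The choice of $\mu_n$ makes
  $\lambda_n^2 s / \mu_n = 2 \lambda_n \sqrt s \, |\widetilde J \beta^*|_2$, which turns the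
  bounds in terms of $\phi$ into those of part (2).
\<close>
theorem corollary1:
  fixes M :: "'w measure"
    and X :: "real ^ 'p ^ 'n" and J :: "real ^ 'p ^ 'd" and beta :: "real ^ 'p"
    and eps :: "'n \<Rightarrow> 'w \<Rightarrow> real" and betahat :: "'w \<Rightarrow> real ^ 'p"
    and \<sigma> \<eta> lam mu c phi L s :: real and B :: "'p set"
  assumes "prob_space M"
    and "\<sigma> > 0"
    and "prob_space.indep_vars M (\<lambda>_. borel) eps UNIV"
    and "\<And>i. distributed M lborel (eps i) (normal_density 0 \<sigma>)"
    and "\<And>j. emp_norm (column j X) \<le> 1"
    and "0 < \<eta>" and "\<eta> < 1"
    and L: "L = ln (real CARD('p) / \<eta>) / real CARD('n)"
    and s: "s = real (card (sparsity_set beta))"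
    and "lam = 4 * sqrt 2 * \<sigma> * sqrt L"
    and "J_tilde J *v beta \<noteq> 0"
    and "mu = lam * sqrt s / (2 * norm (J_tilde J *v beta))"
    and "c \<ge> 1"
    and "sparsity_set beta \<subseteq> B"
    and "real (card B) \<le> c * s"
    and "sparsity_set (J_tilde J *v beta) \<subseteq> B"
    and "restricted_eigenvalue (ext_gram X J mu) B (cone_const J beta lam mu) phi"
    and "\<And>\<omega>. \<omega> \<in> space M \<Longrightarrow> is_quad_estimator X J lam mu (response X beta eps \<omega>) (betahat \<omega>)"
  shows "cone_const J beta lam mu = 6 * sqrt s
    \<and> with_prob_gt M (1 - \<eta>) (\<lambda>\<omega>.
        (emp_norm (X *v beta - X *v betahat \<omega>))\<^sup>2 \<le> 288 * \<sigma>\<^sup>2 / phi * L * s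
        \<and> l1_norm (beta - betahat \<omega>) \<le> 72 * sqrt 2 * \<sigma> / phi * sqrt L * s)
    \<and> (\<forall>phi0. restricted_eigenvalue (ext_gram X J 0) B (cone_const J beta lam 0) phi0
          \<and> phi0 < lam\<^sup>2 * s \<and> phi \<ge> mu \<longrightarrow>
        (\<forall>betalasso :: 'w \<Rightarrow> real ^ 'p.
            (\<forall>\<omega>\<in>space M. is_quad_estimator X J lam 0 (response X beta eps \<omega>) (betalasso \<omega>)) \<longrightarrow>
            with_prob_gt M (1 - \<eta>) (\<lambda>\<omega>.
              (emp_norm (X *v beta - X *v betalasso \<omega>))\<^sup>2 \<le> 288 * \<sigma>\<^sup>2 / phi0 * L * s
              \<and> l1_norm (beta - betalasso \<omega>) \<le> 72 * sqrt 2 * \<sigma> / phi0 * sqrt L * s))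
        \<and> 288 * \<sigma>\<^sup>2 / phi0 * L * s > 9
        \<and> 72 * sqrt 2 * \<sigma> / phi0 * sqrt L * s > 18 / lam
        \<and> with_prob_gt M (1 - \<eta>) (\<lambda>\<omega>.
            (emp_norm (X *v beta - X *v betahat \<omega>))\<^sup>2
               \<le> 72 * sqrt 2 * \<sigma> * norm (J_tilde J *v beta) * sqrt (L * s)
            \<and> (phi \<ge> sqrt mu \<longrightarrow>
                l1_norm (beta - betahat \<omega>)
                  \<le> 36 * sqrt (\<sigma> * norm (J_tilde J *v beta)) * L powr (1/4) * s powr (3/4))))"
proof -
  interpret prob_space M by (rule assms(1))
  define N where "N = norm (J_tilde J *v beta)"
  have \<sigma>: "\<sigma> > 0" and N: "N > 0" using assms(2,11) by (auto simp: N_def)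
  have phi: "phi > 0" using assms(17) by (simp add: restricted_eigenvalue_def)
  have "real CARD('p) \<ge> 1" by (simp add: Suc_le_eq)
  then have "\<eta> < real CARD('p)" using assms(7) by linarith
  then have "real CARD('p) / \<eta> > 1" using assms(6) by (simp add: less_divide_eq)
  then have Lpos: "L > 0" by (simp add: L)
  have lam: "lam = 4 * sqrt 2 * \<sigma> * sqrt L" by (rule assms(10))
  have lampos: "lam > 0" using Lpos \<sigma> by (simp add: lam)
  have lam2: "lam\<^sup>2 = 32 * \<sigma>\<^sup>2 * L" using Lpos by (simp add: lam power_mult_distrib)
  have "beta \<noteq> 0" using assms(11) by auto
  then have spos: "s > 0" by (auto simp: s sparsity_set_def card_gt_0_iff vec_eq_iff)
  have mu: "mu = lam * sqrt s / (2 * N)" using assms(12) by (simp add: N_def)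
  have mupos: "mu > 0" using lampos spos N by (simp add: mu)
  have cone: "cone_const J beta lam mu = 6 * sqrt s"
    using lampos N by (simp add: cone_const_def s [symmetric] N_def [symmetric] mu)
  have cone0: "cone_const J beta lam 0 = 4 * sqrt s"
    by (simp add: cone_const_def s)
  have cols: "\<And>j. emp_norm (column j X) \<le> 1" by (rule assms(5))

  define good where "good \<omega> \<longleftrightarrow> (\<forall>j. \<bar>(\<chi> i. eps i \<omega>) \<bullet> column j X\<bar> \<le> real CARD('n) * lam / 4)" for \<omega>
  have good: "with_prob_gt M (1 - \<eta>) good"
    using noise_event[OF assms(3,4,2) cols assms(6,7)]
    unfolding good_def [abs_def] lam L by (simp add: mult.assoc)

  have quad: "(emp_norm (X *v beta - X *v betahat \<omega>))\<^sup>2 \<le> 9 * (lam\<^sup>2 * s / phi)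
      \<and> l1_norm (beta - betahat \<omega>) \<le> 9 / 2 * (lam * s / phi)"
    if "\<omega> \<in> space M" "good \<omega>" for \<omega>
    using quad_estimator_bounds[OF assms(18)[OF that(1), unfolded response_def] _ lampos _
        assms(14,16,17)]
      that(2) mupos spos by (simp add: good_def cone power_mult_distrib mult_ac)
  have lasso: "(emp_norm (X *v beta - X *v b))\<^sup>2 \<le> 4 * (lam\<^sup>2 * s / phi0)
      \<and> l1_norm (beta - b) \<le> 2 * (lam * s / phi0)"
    if RE0: "restricted_eigenvalue (ext_gram X J 0) B (cone_const J beta lam 0) phi0"
      and est: "is_quad_estimator X J lam 0 (response X beta eps \<omega>) b" and "good \<omega>"
    for phi0 b \<omega>
    using quad_estimator_bounds[OF est[unfolded response_def] _ lampos order_refl assms(14,16) RE0]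
      that(3) spos by (simp add: good_def cone0 power_mult_distrib mult_ac)

  have rhs_fit: "288 * \<sigma>\<^sup>2 / f * L * s = 9 * (lam\<^sup>2 * s / f)" for f
    by (simp add: lam2)
  have rhs_l1: "72 * sqrt 2 * \<sigma> / f * sqrt L * s = 18 * (lam * s / f)" for f
    by (simp add: lam)

  have part1: "with_prob_gt M (1 - \<eta>) (\<lambda>\<omega>.
      (emp_norm (X *v beta - X *v betahat \<omega>))\<^sup>2 \<le> 288 * \<sigma>\<^sup>2 / phi * L * s
      \<and> l1_norm (beta - betahat \<omega>) \<le> 72 * sqrt 2 * \<sigma> / phi * sqrt L * s)"
  proof (rule with_prob_gt_mono[OF good])
    fix \<omega> assume \<omega>: "\<omega> \<in> space M" "good \<omega>"
    have "0 \<le> lam * s / phi" using lampos spos phi by simp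
    with quad[OF \<omega>] show "(emp_norm (X *v beta - X *v betahat \<omega>))\<^sup>2 \<le> 288 * \<sigma>\<^sup>2 / phi * L * s
      \<and> l1_norm (beta - betahat \<omega>) \<le> 72 * sqrt 2 * \<sigma> / phi * sqrt L * s"
      unfolding rhs_fit rhs_l1 by linarith
  qed

  have part2_lasso: "with_prob_gt M (1 - \<eta>) (\<lambda>\<omega>.
      (emp_norm (X *v beta - X *v betalasso \<omega>))\<^sup>2 \<le> 288 * \<sigma>\<^sup>2 / phi0 * L * s
      \<and> l1_norm (beta - betalasso \<omega>) \<le> 72 * sqrt 2 * \<sigma> / phi0 * sqrt L * s)"
    if RE0: "restricted_eigenvalue (ext_gram X J 0) B (cone_const J beta lam 0) phi0"
      and est: "\<forall>\<omega>\<in>space M. is_quad_estimator X J lam 0 (response X beta eps \<omega>) (betalasso \<omega>)"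
    for phi0 and betalasso :: "'w \<Rightarrow> real ^ 'p"
  proof (rule with_prob_gt_mono[OF good])
    fix \<omega> assume \<omega>: "\<omega> \<in> space M" "good \<omega>"
    have "phi0 > 0" using RE0 by (simp add: restricted_eigenvalue_def)
    then have "0 \<le> lam * s / phi0" "0 \<le> lam\<^sup>2 * s / phi0" using lampos spos by simp_all
    with lasso[OF RE0 bspec[OF est \<omega>(1)] \<omega>(2)]
    show "(emp_norm (X *v beta - X *v betalasso \<omega>))\<^sup>2 \<le> 288 * \<sigma>\<^sup>2 / phi0 * L * s
      \<and> l1_norm (beta - betalasso \<omega>) \<le> 72 * sqrt 2 * \<sigma> / phi0 * sqrt L * s"
      unfolding rhs_fit rhs_l1 by linarith
  qed

  have part2_vacuous: "288 * \<sigma>\<^sup>2 / phi0 * L * s > 9"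
      "72 * sqrt 2 * \<sigma> / phi0 * sqrt L * s > 18 / lam"
    if "phi0 > 0" "phi0 < lam\<^sup>2 * s" for phi0
    using that lampos unfolding rhs_fit rhs_l1
    by (simp_all add: field_simps power2_eq_square)

  have part2_quad: "with_prob_gt M (1 - \<eta>) (\<lambda>\<omega>.
      (emp_norm (X *v beta - X *v betahat \<omega>))\<^sup>2 \<le> 72 * sqrt 2 * \<sigma> * N * sqrt (L * s)
      \<and> (phi \<ge> sqrt mu \<longrightarrow> l1_norm (beta - betahat \<omega>)
          \<le> 36 * sqrt (\<sigma> * N) * L powr (1/4) * s powr (3/4)))"
    if phimu: "phi \<ge> mu"
  proof (rule with_prob_gt_mono[OF good])
    fix \<omega> assume \<omega>: "\<omega> \<in> space M" "good \<omega>"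
    have "(emp_norm (X *v beta - X *v betahat \<omega>))\<^sup>2 \<le> 9 * (lam\<^sup>2 * s / phi)"
      using quad[OF \<omega>] by simp
    also have "\<dots> \<le> 9 * (lam\<^sup>2 * s / mu)"
      using phimu mupos phi spos by (intro mult_left_mono divide_left_mono) auto
    also have lsm: "lam\<^sup>2 * s / mu = 2 * lam * N * sqrt s"
      using lampos spos N by (simp add: mu field_simps power2_eq_square)
    finally have fit: "(emp_norm (X *v beta - X *v betahat \<omega>))\<^sup>2 \<le> 72 * sqrt 2 * \<sigma> * N * sqrt (L * s)"
      by (simp add: lam real_sqrt_mult mult_ac)
    have l1: "l1_norm (beta - betahat \<omega>) \<le> 36 * sqrt (\<sigma> * N) * L powr (1/4) * s powr (3/4)"
      if phimu': "phi \<ge> sqrt mu"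
    proof -
      let ?R = "36 * sqrt (\<sigma> * N) * L powr (1/4) * s powr (3/4)"
      have powL: "(L powr (1/4))\<^sup>2 = sqrt L"
        using Lpos by (simp add: powr_power powr_half_sqrt)
      have "(s powr (3/4))\<^sup>2 = s powr (1 + 1/2)" using spos by (simp add: powr_power)
      also have "\<dots> = s * sqrt s" using spos by (subst powr_add) (simp add: powr_half_sqrt)
      finally have pows: "(s powr (3/4))\<^sup>2 = s * sqrt s" .
      have "(9 / 2 * (lam * s / sqrt mu))\<^sup>2 = 81 / 4 * (s * (lam\<^sup>2 * s / mu))"
        using mupos by (simp add: power_mult_distrib power_divide) (simp add: power2_eq_square)
      also have "\<dots> = 162 * sqrt 2 * (\<sigma> * N * sqrt L * (s * sqrt s))"
        unfolding lsm by (simp add: lam mult_ac)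
      also have "\<dots> \<le> 1296 * (\<sigma> * N * sqrt L * (s * sqrt s))"
      proof (rule mult_right_mono)
        have "sqrt 2 < 2" by (rule sqrt2_less_2)
        then show "162 * sqrt 2 \<le> (1296 :: real)" by linarith
      qed (use \<sigma> N Lpos spos in simp)
      also have "\<dots> = ?R\<^sup>2"
        using \<sigma> N by (simp add: power_mult_distrib powL pows)
      finally have "(9 / 2 * (lam * s / sqrt mu))\<^sup>2 \<le> ?R\<^sup>2" .
      then have R: "9 / 2 * (lam * s / sqrt mu) \<le> ?R"
        by (rule power2_le_imp_le) (use \<sigma> N in simp)
      have "l1_norm (beta - betahat \<omega>) \<le> 9 / 2 * (lam * s / phi)"
        using quad[OF \<omega>] by simp
      also have "\<dots> \<le> 9 / 2 * (lam * s / sqrt mu)"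
        using phimu' mupos phi spos lampos by (intro mult_left_mono divide_left_mono) auto
      finally show ?thesis using R by (rule order_trans)
    qed
    show "(emp_norm (X *v beta - X *v betahat \<omega>))\<^sup>2 \<le> 72 * sqrt 2 * \<sigma> * N * sqrt (L * s)
      \<and> (phi \<ge> sqrt mu \<longrightarrow> l1_norm (beta - betahat \<omega>)
          \<le> 36 * sqrt (\<sigma> * N) * L powr (1/4) * s powr (3/4))"
      using fit l1 by blast
  qed

  show ?thesis
  proof (intro conjI allI impI)
    show "cone_const J beta lam mu = 6 * sqrt s" by (rule cone)
  next
    show "with_prob_gt M (1 - \<eta>) (\<lambda>\<omega>.
        (emp_norm (X *v beta - X *v betahat \<omega>))\<^sup>2 \<le> 288 * \<sigma>\<^sup>2 / phi * L * s
        \<and> l1_norm (beta - betahat \<omega>) \<le> 72 * sqrt 2 * \<sigma> / phi * sqrt L * s)"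
      by (rule part1)
  next
    fix phi0 and betalasso :: "'w \<Rightarrow> real ^ 'p"
    assume h: "restricted_eigenvalue (ext_gram X J 0) B (cone_const J beta lam 0) phi0
        \<and> phi0 < lam\<^sup>2 * s \<and> phi \<ge> mu"
      and est: "\<forall>\<omega>\<in>space M. is_quad_estimator X J lam 0 (response X beta eps \<omega>) (betalasso \<omega>)"
    show "with_prob_gt M (1 - \<eta>) (\<lambda>\<omega>.
        (emp_norm (X *v beta - X *v betalasso \<omega>))\<^sup>2 \<le> 288 * \<sigma>\<^sup>2 / phi0 * L * s
        \<and> l1_norm (beta - betalasso \<omega>) \<le> 72 * sqrt 2 * \<sigma> / phi0 * sqrt L * s)"
      by (rule part2_lasso[OF conjunct1[OF h] est])
  next
    fix phi0
    assume h: "restricted_eigenvalue (ext_gram X J 0) B (cone_const J beta lam 0) phi0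
        \<and> phi0 < lam\<^sup>2 * s \<and> phi \<ge> mu"
    then have phi0: "phi0 > 0" "phi0 < lam\<^sup>2 * s" by (simp_all add: restricted_eigenvalue_def)
    show "288 * \<sigma>\<^sup>2 / phi0 * L * s > 9" by (rule part2_vacuous(1)[OF phi0])
    show "72 * sqrt 2 * \<sigma> / phi0 * sqrt L * s > 18 / lam" by (rule part2_vacuous(2)[OF phi0])
    show "with_prob_gt M (1 - \<eta>) (\<lambda>\<omega>.
        (emp_norm (X *v beta - X *v betahat \<omega>))\<^sup>2
           \<le> 72 * sqrt 2 * \<sigma> * norm (J_tilde J *v beta) * sqrt (L * s)
        \<and> (phi \<ge> sqrt mu \<longrightarrow> l1_norm (beta - betahat \<omega>)
              \<le> 36 * sqrt (\<sigma> * norm (J_tilde J *v beta)) * L powr (1/4) * s powr (3/4)))"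
      using part2_quad h unfolding N_def by simp
  qed
qed

end
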